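(* Let $n\ge 1$, let $E_T\subseteq E_S\subseteq\binom{[n]}{2}$ be sets of two-element subsets of $[n]=\{1,\dots,n\}$, and let $r=|E_S|$. Let $\alpha\in\mathbb{R}\setminus\{0\}$ and consider on the fermionic Fock space of $n$ modes the system Hamiltonian $$H_S=\alpha\sum_{\{j,k\}\in E_S,\ j<k}\left(c_j^\dagger c_k+c_k^\dagger c_j\right),$$ and, for arbitrary $\beta_{jk}\in\mathbb{C}$ ($\{j,k\}\in E_T$, $j<k$), the target Hamiltonian $$H_T=\sum_{\{j,k\}\in E_T,\ j<k}\left(\beta_{jk}\,c_j^\dagger c_k+\overline{\beta_{jk}}\,c_k^\dagger c_j\right).$$ Then the time evolution under $H_T$ can be simulated by $2r$ conjugations under local pulses at suitably chosen times. That is, there exist $\mathbf{b}_1,\dots,\mathbf{b}_{2r}\in\mathbb{Z}^n$ and real numbers $\lambda_1,\dots,\lambda_{2r}\ge 0$ such that for every $t\in\mathbb{R}$ $$\lim_{N\to\infty}\left(\prod_{\mu=1}^{2r}V_{\mathbf{b}_\mu}^\dagger\, e^{-i\lambda_\mu H_S t/N}\,V_{\mathbf{b}_\mu}\right)^{N}=e^{-iH_Tt}.$$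
   Context: The Fock space of $n$ fermionic modes is $\mathcal{F}=\bigoplus_{j=0}^n\bigwedge^j\mathbb{C}^n$. On it act the annihilation and creation operators $c_j,c_j^\dagger$ ($j\in[n]$), which satisfy $\{c_j,c_k^\dagger\}=\delta_{jk}$ and $\{c_j,c_k\}=\{c_j^\dagger,c_k^\dagger\}=0$. The number operators are $n_j=c_j^\dagger c_j$. Local unitaries: $V_j=\exp(-\tfrac{2\pi i}{3}n_j)$. Local pulse for $\mathbf{b}\in\mathbb{Z}^n$: $V_{\mathbf{b}}=\prod_{j\in[n]}V_j^{b_j}$. The simulator can evolve freely under $H_S$ and can apply the pulses $V_{\mathbf b}$ at any time. "Simulating" the evolution under $H_T$ means approximating $e^{-iH_Tt}$ by the product $\prod_\mu V_{\mathbf{b}_\mu}^\dagger e^{-i\lambda_\mu H_St}V_{\mathbf{b}_\mu}$, where the $\lambda_\mu\ge0$ are free-evolution durations and the approximation is controlled via Trotterization (repeating the product with time step $t/N$). *)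

theory Defs
  imports "HOL-Analysis.Analysis"
begin

definition cscale :: "complex \<Rightarrow> complex^'m^'m \<Rightarrow> complex^'m^'m" (infixr \<open>*\<^sub>C\<close> 75)
  where "z *\<^sub>C A = (\<chi> i j. z * A $ i $ j)"

definition adj :: "complex^'m^'m \<Rightarrow> complex^'m^'m"
  where "adj A = (\<chi> i j. cnj (A $ j $ i))"

text \<open>The type \<^typ>\<open>complex^'m^'m\<close> carries no ring structure for the matrix product \<^term>\<open>(**)\<close>, so
  powers, ordered products and the exponential series of the library do not apply to it.\<close>

primrec mpow :: "complex^'m^'m \<Rightarrow> nat \<Rightarrow> complex^'m^'m"
  where
    "mpow A 0 = mat 1"
  | "mpow A (Suc k) = A ** mpow A k"

definition mpowi :: "complex^'m^'m \<Rightarrow> int \<Rightarrow> complex^'m^'m"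
  where "mpowi A k = (if 0 \<le> k then mpow A (nat k) else mpow (matrix_inv A) (nat (- k)))"

definition mprod_list :: "(complex^'m^'m) list \<Rightarrow> complex^'m^'m"
  where "mprod_list As = foldr (**) As (mat 1)"

definition mexp :: "complex^'m^'m \<Rightarrow> complex^'m^'m"
  where "mexp A = (\<Sum>k. mpow A k /\<^sub>R fact k)"

lemma norm_mpow_entry_le:
  fixes A :: "complex^'m^'m"
  assumes K: "\<And>i j. norm (A $ i $ j) \<le> K"
  shows "norm (mpow A k $ i $ j) \<le> (real CARD('m) * K) ^ k"
proof (induction k arbitrary: i j)
  case 0
  show ?case by (simp add: mat_def)
next
  case (Suc k)
  have K0: "0 \<le> K" using norm_ge_zero K by (rule order_trans)
  have "norm (mpow A (Suc k) $ i $ j) \<le> (\<Sum>l\<in>UNIV. norm (A $ i $ l * mpow A k $ l $ j))"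
    by (simp add: matrix_matrix_mult_def sum_norm_le)
  also have "\<dots> \<le> (\<Sum>l\<in>(UNIV :: 'm set). K * (real CARD('m) * K) ^ k)"
    unfolding norm_mult by (intro sum_mono mult_mono K Suc K0 norm_ge_zero)
  also have "\<dots> = (real CARD('m) * K) ^ Suc k" by simp
  finally show ?case .
qed

lemma mexp_sums:
  fixes A :: "complex^'m^'m"
  shows "(\<lambda>k. mpow A k /\<^sub>R fact k) sums mexp A"
proof -
  define K where "K = (\<Sum>i\<in>UNIV. \<Sum>j\<in>UNIV. norm (A $ i $ j))"
  have K: "norm (A $ i $ j) \<le> K" for i j
  proof -
    have "norm (A $ i $ j) \<le> (\<Sum>j\<in>UNIV. norm (A $ i $ j))"
      by (rule member_le_sum) auto
    also have "\<dots> \<le> K" unfolding K_def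
      by (rule member_le_sum[where f = "\<lambda>i. \<Sum>j\<in>UNIV. norm (A $ i $ j)"]) (auto intro: sum_nonneg)
    finally show ?thesis .
  qed
  define d where "d = real CARD('m)"
  have bd: "norm (mpow A k /\<^sub>R fact k) \<le> d * d * ((d * K) ^ k /\<^sub>R fact k)" for k
  proof -
    have "norm (mpow A k) \<le> (\<Sum>i\<in>UNIV. norm (mpow A k $ i))"
      by (simp add: norm_vec_def L2_set_le_sum)
    also have "\<dots> \<le> (\<Sum>i\<in>UNIV. \<Sum>j\<in>UNIV. norm (mpow A k $ i $ j))"
      by (intro sum_mono) (simp add: norm_vec_def L2_set_le_sum)
    also have "\<dots> \<le> (\<Sum>i\<in>(UNIV::'m set). \<Sum>j\<in>(UNIV::'m set). (d * K) ^ k)"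
      unfolding d_def by (intro sum_mono norm_mpow_entry_le K)
    also have "\<dots> = d * d * (d * K) ^ k" by (simp add: d_def)
    finally show ?thesis by (simp add: field_simps)
  qed
  have "summable (\<lambda>k. d * d * ((d * K) ^ k /\<^sub>R fact k))"
    by (intro summable_mult summable_exp_generic)
  then have "summable (\<lambda>k. mpow A k /\<^sub>R fact k)"
    by (rule summable_comparison_test'[where N = 0]) (rule bd)
  then show ?thesis unfolding mexp_def by (rule summable_sums)
qed

text \<open>The modes are the elements of a finite linearly ordered type \<^typ>\<open>'n\<close>, so \<open>n = CARD('n)\<close>
  and \<^typ>\<open>'n\<close> is order-isomorphic to \<open>{1,\<dots>,n}\<close>. The Fock space, the sum of all exterior
  powers of \<open>complex^'n\<close>, has the orthonormal basis
  \<open>e\<^sub>S = e\<^bsub>s1\<^esub> \<and> \<dots> \<and> e\<^bsub>sk\<^esub>\<close>, where \<open>S = {s1 < \<dots> < sk}\<close> runs over all sets of modes. It is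
  represented by coordinates in this basis as \<open>complex^('n set)\<close>, and its operators by
  matrices.

  Creation in mode \<open>j\<close> is the left exterior product with \<open>e\<^sub>j\<close>; moving \<open>e\<^sub>j\<close> to its place in
  the increasing order yields the sign.\<close>

definition mode_sign :: "'n::{finite,linorder} \<Rightarrow> 'n set \<Rightarrow> complex"
  where "mode_sign j S = (- 1) ^ card {i \<in> S. i < j}"

definition create :: "'n::{finite,linorder} \<Rightarrow> complex^('n set)^('n set)"
  where "create j = (\<chi> T S. if j \<notin> S \<and> T = insert j S then mode_sign j S else 0)"

definition annihilate :: "'n::{finite,linorder} \<Rightarrow> complex^('n set)^('n set)"
  where "annihilate j = adj (create j)"

lemma create_mult_entry:
  "(create j ** M) $ T $ S = (if j \<in> T then mode_sign j (T - {j}) * M $ (T - {j}) $ S else 0)"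
proof -
  have "(if j \<notin> R \<and> T = insert j R then mode_sign j R else 0) * M $ R $ S =
      (if R = T - {j} then (if j \<in> T then mode_sign j R * M $ R $ S else 0) else 0)" for R
    by auto
  then show ?thesis by (simp add: matrix_matrix_mult_def create_def)
qed

lemma annihilate_mult_entry:
  "(annihilate j ** M) $ T $ S = (if j \<notin> T then mode_sign j T * M $ (insert j T) $ S else 0)"
proof -
  have "cnj (if j \<notin> T \<and> R = insert j T then mode_sign j T else 0) * M $ R $ S =
      (if R = insert j T then (if j \<notin> T then mode_sign j T * M $ R $ S else 0) else 0)" for R
    by (auto simp: mode_sign_def)
  then show ?thesis by (simp add: matrix_matrix_mult_def annihilate_def adj_def create_def)
qed

lemma create_entry: "create j $ T $ S = (if j \<notin> S \<and> T = insert j S then mode_sign j S else 0)"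
  by (simp add: create_def)

lemma annihilate_entry:
  "annihilate j $ T $ S = (if j \<notin> T \<and> S = insert j T then mode_sign j T else 0)"
  by (simp add: annihilate_def adj_def create_def mode_sign_def)

lemma mode_sign_insert:
  "k \<notin> S \<Longrightarrow> mode_sign j (insert k S) = (if k < j then - mode_sign j S else mode_sign j S)"
proof -
  assume k: "k \<notin> S"
  have "{i \<in> insert k S. i < j} =
      (if k < j then insert k {i \<in> S. i < j} else {i \<in> S. i < j})" by auto
  then show ?thesis using k by (simp add: mode_sign_def)
qed

lemma mode_sign_remove:
  "k \<in> S \<Longrightarrow> mode_sign j (S - {k}) = (if k < j then - mode_sign j S else mode_sign j S)"
  using mode_sign_insert[of k "S - {k}" j] by (auto simp: insert_absorb)

lemma mode_sign_sq: "mode_sign j S * mode_sign j S = 1"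
  by (simp add: mode_sign_def flip: power_mult_distrib)

lemma annihilate_create_anticommute:
  "annihilate j ** create k + create k ** annihilate j = mat (if j = k then 1 else 0)"
proof -
  have "(annihilate j ** create k + create k ** annihilate j) $ T $ S
      = mat (if j = k then 1 else 0) $ T $ S" for T S
  proof (cases "j = k")
    case True
    have *: "j \<notin> S \<and> insert j T = insert j S \<longleftrightarrow> T = S" if "j \<notin> T" using that by auto
    have **: "S = insert j (T - {j}) \<longleftrightarrow> T = S" if "j \<in> T" using that by auto
    show ?thesis
    proof (cases "j \<in> T")
      case False
      then show ?thesis using True *
        by (simp add: create_mult_entry annihilate_mult_entry create_entry mat_def mode_sign_sq)
    next
      case jT: True
      then show ?thesis using True **
        by (simp add: create_mult_entry annihilate_mult_entry annihilate_entry mat_def mode_sign_sq)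
    qed
  next
    case False
    show ?thesis
    proof (cases "j \<notin> T \<and> k \<in> T \<and> S = insert j (T - {k})")
      case True
      have S: "S = insert j (T - {k})" and j: "j \<notin> T" and k: "k \<in> T" using True by auto
      have ins: "insert j T = insert k S" "k \<notin> S" using S j k False by auto
      have sS: "mode_sign k S = (if j < k then - mode_sign k (T - {k}) else mode_sign k (T - {k}))"
        unfolding S using j by (intro mode_sign_insert) simp
      have sT: "mode_sign j (T - {k}) = (if k < j then - mode_sign j T else mode_sign j T)"
        using k by (rule mode_sign_remove)
      have "(annihilate j ** create k) $ T $ S = mode_sign j T * mode_sign k S"
        using j ins by (simp add: annihilate_mult_entry create_entry)
      moreover have "(create k ** annihilate j) $ T $ S
          = mode_sign k (T - {k}) * mode_sign j (T - {k})"
        using j k S by (simp add: create_mult_entry annihilate_entry)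
      ultimately show ?thesis using False sS sT by (cases j k rule: linorder_cases) (simp_all add: mat_def)
    next
      case ne: False
      have "\<not> (j \<notin> T \<and> k \<notin> S \<and> insert j T = insert k S)"
      proof
        assume *: "j \<notin> T \<and> k \<notin> S \<and> insert j T = insert k S"
        then have "k \<in> T" using False by (metis insertE insertI1)
        moreover have "S = insert j T - {k}" using * by simp
        then have "S = insert j (T - {k})" using False by (simp add: insert_Diff_if)
        ultimately show False using ne * by simp
      qed
      then have "(annihilate j ** create k) $ T $ S = 0"
        by (auto simp: annihilate_mult_entry create_entry)
      moreover have "\<not> (k \<in> T \<and> j \<notin> T - {k} \<and> S = insert j (T - {k}))" using ne False by simp
      then have "(create k ** annihilate j) $ T $ S = 0"
        by (auto simp: create_mult_entry annihilate_entry)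
      ultimately show ?thesis using False by (simp add: mat_def)
    qed
  qed
  then show ?thesis by (simp add: vec_eq_iff)
qed

lemma annihilate_annihilate_anticommute:
  "annihilate j ** annihilate k + annihilate k ** annihilate j = 0"
proof -
  have "(annihilate j ** annihilate k + annihilate k ** annihilate j) $ T $ S = 0" for T S
    by (cases "j \<in> T"; cases "k \<in> T"; cases "j = k"; cases "j < k")
       (auto simp: annihilate_mult_entry annihilate_entry mode_sign_insert insert_commute)
  then show ?thesis by (simp add: vec_eq_iff)
qed

lemma adj_mult: "adj (A ** B) = adj B ** adj A"
  by (simp add: adj_def matrix_matrix_mult_def vec_eq_iff mult.commute)

lemma adj_add: "adj (A + B) = adj A + adj B"
  by (simp add: adj_def vec_eq_iff)

lemma adj_adj: "adj (adj A) = A"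
  by (simp add: adj_def vec_eq_iff)

lemma create_create_anticommute: "create j ** create k + create k ** create j = 0"
proof -
  have "adj (annihilate k ** annihilate j + annihilate j ** annihilate k) = 0"
    unfolding annihilate_annihilate_anticommute by (simp add: adj_def vec_eq_iff)
  then show ?thesis by (simp add: adj_add adj_mult annihilate_def adj_adj)
qed

definition number_op :: "'n::{finite,linorder} \<Rightarrow> complex^('n set)^('n set)"
  where "number_op j = create j ** annihilate j"

definition local_unitary :: "'n::{finite,linorder} \<Rightarrow> complex^('n set)^('n set)"
  where "local_unitary j = mexp ((- (2 * of_real pi * \<i> / 3)) *\<^sub>C number_op j)"

definition pulse :: "int^'n::{finite,linorder} \<Rightarrow> complex^('n set)^('n set)"
  where "pulse b = mprod_list (map (\<lambda>j. mpowi (local_unitary j) (b $ j)) (sorted_list_of_set UNIV))"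

definition system_hamiltonian ::
    "real \<Rightarrow> 'n::{finite,linorder} set set \<Rightarrow> complex^('n set)^('n set)"
  where "system_hamiltonian \<alpha> E = of_real \<alpha> *\<^sub>C
    (\<Sum>(j, k) \<in> {(j, k). j < k \<and> {j, k} \<in> E}.
       create j ** annihilate k + create k ** annihilate j)"

definition target_hamiltonian ::
    "('n::{finite,linorder} \<Rightarrow> 'n \<Rightarrow> complex) \<Rightarrow> 'n set set \<Rightarrow> complex^('n set)^('n set)"
  where "target_hamiltonian \<beta> E =
    (\<Sum>(j, k) \<in> {(j, k). j < k \<and> {j, k} \<in> E}.
       \<beta> j k *\<^sub>C (create j ** annihilate k) + cnj (\<beta> j k) *\<^sub>C (create k ** annihilate j))"

definition evolution :: "complex^'m^'m \<Rightarrow> real \<Rightarrow> complex^'m^'m"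
  where "evolution H t = mexp ((- \<i> * of_real t) *\<^sub>C H)"

end

theory Submission
  imports Defs
begin

text \<open>Conjugation by the pulse with vector \<open>b\<close> multiplies the hopping term from mode \<open>k\<close> to
  mode \<open>j\<close> by \<open>exp (2\<pi>i (b j - b k) / 3)\<close>, a character of \<open>(\<int>/3)\<^sup>n\<close> in \<open>b\<close>. The characters of distinct edges and their
  conjugates are pairwise distinct and nontrivial, so by Fourier inversion every vector of edge
  weights in \<open>\<complex>\<^sup>r\<close> is a nonnegative combination of these phase vectors, and by Caratheodory's theorem
  for cones in \<open>\<complex>\<^sup>r = \<real>\<^sup>2\<^sup>r\<close> it is one of at most \<open>2r\<close> of them. The Trotter product formula then turns the
  resulting decomposition of the target Hamiltonian into the limit of products.\<close>

section \<open>The Trotter product formula\<close>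

text \<open>A copy of the bounded endomorphisms, since the library type of bounded linear maps allows different
  domain and codomain and therefore has no ring structure, which \<^const>\<open>exp\<close> requires.\<close>

typedef (overloaded) 'a endo = "UNIV :: ('a::real_normed_vector \<Rightarrow>\<^sub>L 'a) set"
  morphisms blinfun_of_endo Endo ..

setup_lifting type_definition_endo

instantiation endo :: (real_normed_vector) real_vector
begin

lift_definition zero_endo :: "'a endo" is 0 .
lift_definition plus_endo :: "'a endo \<Rightarrow> 'a endo \<Rightarrow> 'a endo" is "(+)" .
lift_definition minus_endo :: "'a endo \<Rightarrow> 'a endo \<Rightarrow> 'a endo" is "(-)" .
lift_definition uminus_endo :: "'a endo \<Rightarrow> 'a endo" is uminus .
lift_definition scaleR_endo :: "real \<Rightarrow> 'a endo \<Rightarrow> 'a endo" is "(*\<^sub>R)" .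

instance
  by standard (transfer; simp add: algebra_simps)+

end

instantiation endo :: (real_normed_vector) real_normed_algebra
begin

lift_definition times_endo :: "'a endo \<Rightarrow> 'a endo \<Rightarrow> 'a endo" is "(o\<^sub>L)" .
lift_definition norm_endo :: "'a endo \<Rightarrow> real" is norm .
lift_definition sgn_endo :: "'a endo \<Rightarrow> 'a endo" is sgn .

definition dist_endo :: "'a endo \<Rightarrow> 'a endo \<Rightarrow> real"
  where "dist_endo f g = norm (f - g)"

definition uniformity_endo :: "('a endo \<times> 'a endo) filter"
  where [code del]: "uniformity_endo = (INF e\<in>{0<..}. principal {(f, g). dist f g < e})"

definition open_endo :: "'a endo set \<Rightarrow> bool"
  where [code del]: "open_endo S = (\<forall>f\<in>S. \<forall>\<^sub>F (f', g) in uniformity. f' = f \<longrightarrow> g \<in> S)"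

instance
proof
  fix f g h :: "'a endo" and r :: real
  show "f * g * h = f * (g * h)" "(f + g) * h = f * h + g * h" "f * (g + h) = f * g + f * h"
    "r *\<^sub>R f * g = r *\<^sub>R (f * g)" "f * r *\<^sub>R g = r *\<^sub>R (f * g)"
    by (transfer, rule blinfun_eqI, simp add: blinfun.bilinear_simps)+
  show "sgn f = f /\<^sub>R norm f" by transfer (simp add: sgn_div_norm)
  show "norm f = 0 \<longleftrightarrow> f = 0" by transfer simp
  show "norm (f + g) \<le> norm f + norm g" by transfer (rule norm_triangle_ineq)
  show "norm (r *\<^sub>R f) = \<bar>r\<bar> * norm f" by transfer simp
  show "norm (f * g) \<le> norm f * norm g" by transfer (rule norm_blinfun_compose)
qed (rule dist_endo_def uniformity_endo_def open_endo_def)+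

end

text \<open>The constraint \<open>perfect_space\<close> rules out the zero space, where the identity
  would be 0 and have norm 0.\<close>

instantiation endo :: ("{real_normed_vector, perfect_space}") real_normed_algebra_1
begin

lift_definition one_endo :: "'a endo" is id_blinfun .

instance
proof
  fix f :: "'a endo"
  show "1 * f = f" "f * 1 = f"
    by (transfer, rule blinfun_eqI, simp)+
  show n: "norm (1 :: 'a endo) = 1" by transfer simp
  show "(0 :: 'a endo) \<noteq> 1"
    using n norm_zero[where 'a = "'a endo"] by force
qed

end

lemma dist_blinfun_of_endo: "dist (blinfun_of_endo f) (blinfun_of_endo g) = dist f g"
  unfolding dist_norm by transfer (rule refl)

text \<open>Completeness carries over because \<open>blinfun_of_endo\<close> is a surjective
  isometry.\<close>

instance endo :: (banach) banach
proof
  fix X :: "nat \<Rightarrow> 'a endo"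
  assume "Cauchy X"
  then have "Cauchy (\<lambda>n. blinfun_of_endo (X n))"
    unfolding Cauchy_def dist_blinfun_of_endo .
  then obtain L where "(\<lambda>n. blinfun_of_endo (X n)) \<longlonglongrightarrow> L"
    using Cauchy_convergent convergent_def by blast
  then have "X \<longlonglongrightarrow> Endo L"
    by (simp add: tendsto_iff Endo_inverse flip: dist_blinfun_of_endo)
  then show "convergent X" by (rule convergentI)
qed

section \<open>The product formula in a Banach algebra\<close>

lemma norm_prod_list_exp_le:
  fixes xs :: "'a::{real_normed_algebra_1,banach} list"
  shows "norm (prod_list (map exp xs)) \<le> exp (sum_list (map norm xs))"
proof (induction xs)
  case (Cons x xs)
  have "norm (prod_list (map exp (x # xs))) \<le> norm (exp x) * norm (prod_list (map exp xs))"
    by (simp add: norm_mult_ineq)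
  also have "\<dots> \<le> exp (norm x) * exp (sum_list (map norm xs))"
    by (intro mult_mono norm_exp Cons.IH) auto
  finally show ?case by (simp add: exp_add)
qed simp

text \<open>At 0 every factor equals 1, so the product rule leaves only the sum of the generators,
  whatever their order. This is the first-order agreement with
  \<open>exp (s *\<^sub>R sum_list xs)\<close> on which the product formula rests.\<close>

lemma prod_list_exp_has_vector_derivative:
  fixes xs :: "'a::{real_normed_algebra_1,banach} list"
  shows "((\<lambda>s::real. prod_list (map (\<lambda>x. exp (s *\<^sub>R x)) xs)) has_vector_derivative sum_list xs) (at 0)"
proof (induction xs)
  case (Cons x xs)
  have "((\<lambda>s. exp (s *\<^sub>R x)) has_vector_derivative exp (0 *\<^sub>R x) * x) (at 0)"
    by (rule exp_scaleR_has_vector_derivative_right)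
  from has_vector_derivative_mult[OF this Cons.IH]
  have "((\<lambda>s. exp (s *\<^sub>R x) * prod_list (map (\<lambda>x. exp (s *\<^sub>R x)) xs)) has_vector_derivative
      (sum_list xs + x * prod_list (map (\<lambda>x. 1) xs))) (at 0)" by simp
  moreover have "prod_list (map (\<lambda>x. 1) xs) = (1::'a)" by (induction xs) auto
  ultimately show ?case by (simp add: add.commute)
qed simp

text \<open>Telescoping: the factors \<open>x\<close> are replaced by \<open>y\<close> one at a
  time, and each replacement costs at most \<open>norm (x - y)\<close> because the remaining factors
  have norm at most 1.\<close>

lemma norm_power_diff_noncomm:
  fixes x y :: "'a::real_normed_algebra_1"
  assumes "norm x \<le> 1" "norm y \<le> 1"
  shows "norm (x ^ n - y ^ n) \<le> real n * norm (x - y)"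
proof (induction n)
  case (Suc n)
  have "x ^ Suc n - y ^ Suc n = x * (x ^ n - y ^ n) + (x - y) * y ^ n"
    by (simp add: algebra_simps)
  also have "norm \<dots> \<le> norm x * norm (x ^ n - y ^ n) + norm (x - y) * norm (y ^ n)"
    by (intro norm_triangle_le add_mono norm_mult_ineq)
  also have "\<dots> \<le> 1 * (real n * norm (x - y)) + norm (x - y) * 1"
    using assms power_le_one[of "norm y" n] norm_power_ineq[of y n] Suc.IH
    by (intro add_mono mult_mono) auto
  finally show ?case by (simp add: algebra_simps)
qed simp

lemma exp_of_nat_scaleR:
  fixes x :: "'a::{real_normed_algebra_1,banach}"
  shows "exp (real n *\<^sub>R x) = exp x ^ n"
proof (induction n)
  case (Suc n)
  have "exp (x + real n *\<^sub>R x) = exp x * exp (real n *\<^sub>R x)"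
    by (rule exp_add_commuting) simp
  then show ?case using Suc by (simp add: algebra_simps)
qed simp

text \<open>Both sides are \<open>N\<close>-th powers of \<open>X N\<close> and \<open>Y N\<close>, which agree up to \<open>o(1/N)\<close>; after division by
  \<open>exp (a/N)\<close> both have norm at most 1, so that the error only grows by the factor \<open>N\<close>.\<close>

theorem trotter_product:
  fixes xs :: "'a::{real_normed_algebra_1,banach} list"
  shows "(\<lambda>N. prod_list (map (\<lambda>x. exp (x /\<^sub>R real N)) xs) ^ N) \<longlonglongrightarrow> exp (sum_list xs)"
proof -
  define s where "s = sum_list xs"
  define a where "a = sum_list (map norm xs)"
  \<comment> \<open>The error of a single step of length \<open>r\<close>. Its value and its first
    derivative vanish at 0, so it is o(r).\<close>
  define F where "F r = prod_list (map (\<lambda>x. exp (r *\<^sub>R x)) xs) - exp (r *\<^sub>R s)" for r :: real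
  have sa: "norm s \<le> a"
    unfolding s_def a_def
    by (induction xs) (auto intro: norm_triangle_le)
  have "((\<lambda>r. exp (r *\<^sub>R s)) has_vector_derivative exp (0 *\<^sub>R s) * s) (at 0)"
    by (rule exp_scaleR_has_vector_derivative_right)
  from has_vector_derivative_diff[OF prod_list_exp_has_vector_derivative[of xs] this]
  have F': "(F has_vector_derivative 0) (at 0)"
    unfolding F_def by (simp add: s_def)
  have F0: "F 0 = 0"
    unfolding F_def by (induction xs) auto
  have "(\<lambda>r. norm (F r) / norm r) \<midarrow>0\<rightarrow> 0"
    using F' F0 by (simp add: has_vector_derivative_def has_derivative_at)
  moreover have "filterlim (\<lambda>N. inverse (real N)) (at 0) sequentially"
    unfolding filterlim_at using lim_inverse_n by (auto intro: eventually_mono[OF eventually_gt_at_top[of 0]])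
  ultimately have "(\<lambda>N. norm (F (inverse (real N))) / norm (inverse (real N))) \<longlonglongrightarrow> 0"
    by (rule filterlim_compose)
  then have lim: "(\<lambda>N. exp a * (real N * norm (F (inverse (real N))))) \<longlonglongrightarrow> 0"
    by (intro tendsto_mult_right_zero) (simp add: divide_inverse mult.commute)
  have bound: "norm (prod_list (map (\<lambda>x. exp (x /\<^sub>R real N)) xs) ^ N - exp s)
      \<le> exp a * (real N * norm (F (inverse (real N))))" if N: "N > 0" for N
  proof -
    define X where "X = prod_list (map (\<lambda>x. exp (x /\<^sub>R real N)) xs)"
    define Y where "Y = exp (s /\<^sub>R real N)"
    define c where "c = exp (- a / real N)"
    have c: "c > 0" "c * exp (a / real N) = 1" by (auto simp: c_def simp flip: exp_add)
    have "norm X \<le> exp (sum_list (map norm (map (\<lambda>x. x /\<^sub>R real N) xs)))"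
      using norm_prod_list_exp_le[of "map (\<lambda>x. x /\<^sub>R real N) xs"] by (simp add: X_def o_def)
    also have "sum_list (map norm (map (\<lambda>x. x /\<^sub>R real N) xs)) = a / real N"
      unfolding a_def by (induction xs) (auto simp: divide_inverse algebra_simps)
    finally have X: "norm (c *\<^sub>R X) \<le> 1"
      using c by (metis abs_of_pos mult_left_mono norm_scaleR order_less_imp_le)
    have "norm Y \<le> exp (norm s / real N)"
      unfolding Y_def using norm_exp[of "s /\<^sub>R real N"] by (simp add: divide_inverse mult.commute)
    also have "\<dots> \<le> exp (a / real N)"
      using sa by (simp add: divide_right_mono)
    finally have Y: "norm (c *\<^sub>R Y) \<le> 1"
      using c by (metis abs_of_pos mult_left_mono norm_scaleR order_less_imp_le)
    have cN: "c ^ N = exp (- a)"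
      using N by (simp add: c_def flip: exp_of_nat_mult)
    have YN: "Y ^ N = exp s"
      using N by (simp add: Y_def flip: exp_of_nat_scaleR)
    have "norm ((c *\<^sub>R X) ^ N - (c *\<^sub>R Y) ^ N) \<le> real N * norm (c *\<^sub>R X - c *\<^sub>R Y)"
      by (rule norm_power_diff_noncomm[OF X Y])
    also have "(c *\<^sub>R X) ^ N - (c *\<^sub>R Y) ^ N = exp (- a) *\<^sub>R (X ^ N - exp s)"
      by (simp only: scaleR_power cN YN scaleR_diff_right)
    also have "norm (c *\<^sub>R X - c *\<^sub>R Y) = c * norm (X - Y)"
      using c by (simp flip: scaleR_diff_right)
    also have "\<dots> \<le> norm (X - Y)"
      using order_trans[OF norm_ge_zero sa] by (intro mult_left_le_one_le) (auto simp: c_def)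
    also have "X - Y = F (inverse (real N))"
      by (simp add: X_def Y_def F_def)
    finally have "exp (- a) * norm (X ^ N - exp s) \<le> real N * norm (F (inverse (real N)))"
      by (simp add: mult_left_mono)
    then show ?thesis
      unfolding X_def[symmetric] by (simp add: exp_minus field_simps)
  qed
  show ?thesis
    unfolding s_def[symmetric]
    by (rule Lim_transform[OF tendsto_const], rule Lim_null_comparison[OF _ lim])
       (auto intro!: eventually_mono[OF eventually_gt_at_top[of 0]] bound)
qed

section \<open>Transfer from endomorphisms to matrices\<close>

definition endo_of_matrix :: "complex^'m^'m \<Rightarrow> (complex^'m) endo"
  where "endo_of_matrix A = Endo (Blinfun ((*v) A))"

lemma endo_of_matrix_apply [simp]:
  "blinfun_apply (blinfun_of_endo (endo_of_matrix A)) x = A *v x"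
  by (simp add: endo_of_matrix_def Endo_inverse bounded_linear_Blinfun_apply)

lemma endo_eqI: "(\<And>x. blinfun_of_endo f x = blinfun_of_endo g x) \<Longrightarrow> f = g"
  by (metis blinfun_eqI blinfun_of_endo_inject)

lemma endo_of_matrix_mult: "endo_of_matrix (A ** B) = endo_of_matrix A * endo_of_matrix B"
  by (rule endo_eqI) (simp add: times_endo.rep_eq matrix_vector_mul_assoc)

lemma endo_of_matrix_1: "endo_of_matrix (mat 1) = 1"
  by (rule endo_eqI) (simp add: one_endo.rep_eq)

lemma linear_endo_of_matrix: "linear endo_of_matrix"
proof (rule linearI)
  fix A B :: "complex^'m^'m" and r :: real
  show "endo_of_matrix (A + B) = endo_of_matrix A + endo_of_matrix B"
    by (rule endo_eqI)
      (simp add: plus_endo.rep_eq blinfun.bilinear_simps matrix_vector_mult_add_rdistrib)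
  show "endo_of_matrix (r *\<^sub>R A) = r *\<^sub>R endo_of_matrix A"
    by (rule endo_eqI)
      (simp add: scaleR_endo.rep_eq blinfun.bilinear_simps matrix_vector_mult_def vec_eq_iff
        scaleR_sum_right)
qed

lemma endo_of_matrix_mpow: "endo_of_matrix (mpow A k) = endo_of_matrix A ^ k"
  by (induction k) (simp_all add: endo_of_matrix_1 endo_of_matrix_mult)

lemma endo_of_matrix_mprod_list:
  "endo_of_matrix (mprod_list As) = prod_list (map endo_of_matrix As)"
  unfolding mprod_list_def by (induction As) (simp_all add: endo_of_matrix_1 endo_of_matrix_mult)

lemma endo_of_matrix_mexp: "endo_of_matrix (mexp A) = exp (endo_of_matrix A)"
proof -
  have "(\<lambda>k. endo_of_matrix (mpow A k /\<^sub>R fact k)) sums endo_of_matrix (mexp A)"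
    using linear_endo_of_matrix
    by (intro bounded_linear.sums[OF _ mexp_sums]) (simp add: linear_conv_bounded_linear)
  then have "(\<lambda>k. endo_of_matrix A ^ k /\<^sub>R fact k) sums endo_of_matrix (mexp A)"
    by (simp add: linear_cmul[OF linear_endo_of_matrix] endo_of_matrix_mpow)
  then show ?thesis
    unfolding exp_def by (rule sums_unique)
qed

text \<open>Convergence in operator norm implies convergence on each \<open>axis j 1\<close>, whose
  images are the columns.\<close>

lemma tendsto_matrix_of_endo:
  assumes "((\<lambda>x. endo_of_matrix (F x)) \<longlongrightarrow> endo_of_matrix L) net"
  shows "(F \<longlongrightarrow> L) net"
proof (intro vec_tendstoI)
  fix i j
  have "((\<lambda>x. blinfun_of_endo (endo_of_matrix (F x))) \<longlongrightarrow> blinfun_of_endo (endo_of_matrix L)) net"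
    using assms by (simp add: tendsto_iff dist_blinfun_of_endo)
  from tendsto_vec_nth[OF blinfun.tendsto[OF this tendsto_const[of "axis j 1"]], of i]
  show "((\<lambda>x. F x $ i $ j) \<longlongrightarrow> L $ i $ j) net"
    by (simp add: matrix_vector_mult_def axis_def if_distrib cong: if_cong)
qed

text \<open>\<open>endo_of_matrix\<close> respects sums, products, powers and exponentials, so the
  formula for the Banach algebra of endomorphisms pulls back to matrices.\<close>

theorem matrix_trotter_product:
  fixes As :: "(complex^'m^'m) list"
  shows "(\<lambda>N. mpow (mprod_list (map (\<lambda>A. mexp (A /\<^sub>R real N)) As)) N) \<longlonglongrightarrow> mexp (sum_list As)"
proof (rule tendsto_matrix_of_endo)
  have "endo_of_matrix (sum_list As) = sum_list (map endo_of_matrix As)"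
    by (induction As) (simp_all add: linear_0[OF linear_endo_of_matrix] linear_add[OF linear_endo_of_matrix])
  then show "(\<lambda>N. endo_of_matrix (mpow (mprod_list (map (\<lambda>A. mexp (A /\<^sub>R real N)) As)) N))
      \<longlonglongrightarrow> endo_of_matrix (mexp (sum_list As))"
    using trotter_product[of "map endo_of_matrix As"]
    by (simp add: endo_of_matrix_mpow endo_of_matrix_mprod_list endo_of_matrix_mexp o_def
        linear_cmul[OF linear_endo_of_matrix])
qed

section \<open>Conjugation of the Hamiltonian by pulses\<close>

lemma matrix_add_rdistrib: "(A + B) ** C = A ** C + (B ** C :: 'a::semiring_1^'n^'m)"
  by (simp add: matrix_matrix_mult_def vec_eq_iff sum.distrib distrib_right)

text \<open>The inner factors \<open>V ** U\<close> cancel in every power, and conjugation, being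
  linear in finite dimension and hence continuous, passes through the exponential series.\<close>

lemma mexp_conjugate:
  fixes A U V :: "complex^'m^'m"
  assumes "V ** U = mat 1" "U ** V = mat 1"
  shows "mexp (U ** A ** V) = U ** mexp A ** V"
proof -
  have mpow: "mpow (U ** A ** V) k = U ** mpow A k ** V" for k
  proof (induction k)
    case (Suc k)
    have "mpow (U ** A ** V) (Suc k) = U ** A ** (V ** U) ** mpow A k ** V"
      by (simp add: Suc matrix_mul_assoc)
    then show ?case using assms by (simp add: matrix_mul_assoc)
  qed (use assms in simp)
  have lin: "linear (\<lambda>A. U ** A ** V)"
    by (rule linearI)
      (simp_all add: matrix_add_ldistrib matrix_add_rdistrib matrix_scalar_ac scalar_matrix_assoc)
  have "(\<lambda>k. U ** (mpow A k /\<^sub>R fact k) ** V) sums (U ** mexp A ** V)"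
    using lin by (intro bounded_linear.sums[OF _ mexp_sums]) (simp add: linear_conv_bounded_linear)
  then have "(\<lambda>k. mpow (U ** A ** V) k /\<^sub>R fact k) sums (U ** mexp A ** V)"
    by (simp add: linear_cmul[OF lin] mpow)
  then show ?thesis
    unfolding mexp_def by (rule sums_unique[symmetric])
qed

section \<open>Diagonal matrices and the pulses\<close>

definition diag_mat :: "('m \<Rightarrow> complex) \<Rightarrow> complex^'m^'m"
  where "diag_mat d = (\<chi> i j. if i = j then d i else 0)"

lemma diag_mat_mult_entry: "(diag_mat d ** A) $ i $ j = d i * A $ i $ j"
  by (simp add: diag_mat_def matrix_matrix_mult_def if_distrib[of "\<lambda>x. x * _"] cong: if_cong)

lemma mult_diag_mat_entry: "(A ** diag_mat d) $ i $ j = A $ i $ j * d j"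
  by (simp add: diag_mat_def matrix_matrix_mult_def if_distrib[of "\<lambda>x. _ * x"] cong: if_cong)

lemma mat_eq_diag_mat: "mat c = diag_mat (\<lambda>_. c)"
  by (simp add: mat_def diag_mat_def)

lemma diag_mat_mult: "diag_mat d ** diag_mat e = diag_mat (\<lambda>i. d i * e i)"
  by (simp add: vec_eq_iff diag_mat_mult_entry) (simp add: diag_mat_def)

lemma mpow_diag_mat: "mpow (diag_mat d) k = diag_mat (\<lambda>i. d i ^ k)"
  by (induction k) (simp_all add: mat_eq_diag_mat diag_mat_mult)

lemma mprod_list_diag_mat:
  "mprod_list (map (\<lambda>x. diag_mat (d x)) xs) = diag_mat (\<lambda>i. \<Prod>x\<leftarrow>xs. d x i)"
  unfolding mprod_list_def by (induction xs) (simp_all add: mat_eq_diag_mat diag_mat_mult)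

lemma mexp_diag_mat: "mexp (diag_mat d) = diag_mat (\<lambda>i. exp (d i))"
proof -
  have "mexp (diag_mat d) $ i $ j = diag_mat (\<lambda>i. exp (d i)) $ i $ j" for i j
  proof -
    have "(\<lambda>k. (mpow (diag_mat d) k /\<^sub>R fact k) $ i $ j) sums (mexp (diag_mat d) $ i $ j)"
      by (intro bounded_linear.sums[OF bounded_linear_vec_nth] mexp_sums)
    moreover have "(\<lambda>k. (mpow (diag_mat d) k /\<^sub>R fact k) $ i $ j) sums (diag_mat (\<lambda>i. exp (d i)) $ i $ j)"
      using exp_converges[of "d i"] by (simp add: mpow_diag_mat) (auto simp: diag_mat_def)
    ultimately show ?thesis by (rule sums_unique2)
  qed
  then show ?thesis by (simp add: vec_eq_iff)
qed

lemma matrix_inv_diag_mat: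
  assumes "\<And>i. d i \<noteq> 0"
  shows "matrix_inv (diag_mat d) = diag_mat (\<lambda>i. inverse (d i))"
proof -
  have 1: "diag_mat d ** diag_mat (\<lambda>i. inverse (d i)) = mat 1"
    "diag_mat (\<lambda>i. inverse (d i)) ** diag_mat d = mat 1"
    using assms by (simp_all add: diag_mat_mult mat_eq_diag_mat)
  \<comment> \<open>\<open>matrix_inv\<close> chooses some two-sided inverse. The matrix of
    reciprocals shows that one exists, and multiplying by it identifies the chosen one.\<close>
  then have "matrix_inv (diag_mat d) ** diag_mat d = mat 1"
    unfolding matrix_inv_def by (metis (mono_tags, lifting) someI)
  then have "matrix_inv (diag_mat d) ** (diag_mat d ** diag_mat (\<lambda>i. inverse (d i)))
      = diag_mat (\<lambda>i. inverse (d i))"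
    by (simp add: matrix_mul_assoc)
  then show ?thesis by (simp add: 1)
qed

lemma mpowi_diag_mat:
  assumes "\<And>i. d i \<noteq> 0"
  shows "mpowi (diag_mat d) k = diag_mat (\<lambda>i. d i powi k)"
  using assms by (simp add: mpowi_def mpow_diag_mat matrix_inv_diag_mat power_int_def)

lemma adj_diag_mat: "adj (diag_mat d) = diag_mat (\<lambda>i. cnj (d i))"
  by (auto simp: adj_def diag_mat_def vec_eq_iff)

text \<open>Removing mode \<open>j\<close> and putting it back produces the same sign twice, and
  signs square to 1.\<close>

lemma number_op_eq: "number_op j = diag_mat (\<lambda>S. if j \<in> S then 1 else 0)"
proof -
  have "number_op j $ T $ S = diag_mat (\<lambda>S. if j \<in> S then 1 else 0) $ T $ S" for T S
    by (cases "j \<in> T")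
      (auto simp: number_op_def create_mult_entry annihilate_entry diag_mat_def mode_sign_sq insert_absorb)
  then show ?thesis by (simp add: vec_eq_iff)
qed

text \<open>A primitive cube root of unity: the eigenvalue of \<open>local_unitary j\<close> when
  mode \<open>j\<close> is occupied.\<close>

definition pulse_root :: complex
  where "pulse_root = exp (- (2 * of_real pi * \<i> / 3))"

lemma local_unitary_eq: "local_unitary j = diag_mat (\<lambda>S. if j \<in> S then pulse_root else 1)"
proof -
  have "c *\<^sub>C diag_mat d = diag_mat (\<lambda>i. c * d i)" for c and d :: "'a set \<Rightarrow> complex"
    by (simp add: cscale_def diag_mat_def vec_eq_iff)
  then show ?thesis
    by (simp add: local_unitary_def number_op_eq mexp_diag_mat pulse_root_def if_distrib cong: if_cong)
qed

lemma pulse_root_nonzero: "pulse_root \<noteq> 0"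
  by (simp add: pulse_root_def)

text \<open>The eigenvalue of \<open>pulse b\<close> on the basis vector of \<open>S\<close>; only
  occupied modes contribute.\<close>

definition pulse_phase :: "int^'n::finite \<Rightarrow> 'n set \<Rightarrow> complex"
  where "pulse_phase b S = (\<Prod>j\<in>S. pulse_root powi (b $ j))"

lemma pulse_eq: "pulse b = diag_mat (pulse_phase b)"
proof -
  have "pulse b = diag_mat (\<lambda>S. \<Prod>j\<leftarrow>sorted_list_of_set UNIV. (if j \<in> S then pulse_root else 1) powi (b $ j))"
    by (simp add: pulse_def local_unitary_eq mpowi_diag_mat pulse_root_nonzero mprod_list_diag_mat)
  also have "(\<lambda>S. \<Prod>j\<leftarrow>sorted_list_of_set UNIV. (if j \<in> S then pulse_root else 1) powi (b $ j))
      = pulse_phase b"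
  proof
    fix S
    have "(\<Prod>j\<leftarrow>sorted_list_of_set UNIV. (if j \<in> S then pulse_root else 1) powi (b $ j))
        = (\<Prod>j\<in>UNIV. (if j \<in> S then pulse_root else 1) powi (b $ j))"
      by (simp add: flip: prod.distinct_set_conv_list)
    also have "\<dots> = (\<Prod>j\<in>UNIV. if j \<in> S then pulse_root powi (b $ j) else 1)"
      by (intro prod.cong) auto
    also have "\<dots> = pulse_phase b S"
      by (simp add: pulse_phase_def prod.If_cases)
    finally show "(\<Prod>j\<leftarrow>sorted_list_of_set UNIV. (if j \<in> S then pulse_root else 1) powi (b $ j))
        = pulse_phase b S" .
  qed
  finally show ?thesis .
qed

lemma cnj_pulse_root: "cnj pulse_root = inverse pulse_root"
  by (simp add: pulse_root_def exp_cnj exp_minus)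

lemma cnj_pulse_root_powi: "cnj pulse_root powi k = pulse_root powi (- k)"
  by (simp add: cnj_pulse_root power_int_minus power_int_inverse)

lemma pulse_phase_cnj: "cnj (pulse_phase b S) * pulse_phase b S = 1"
  by (simp add: pulse_phase_def cnj_pulse_root_powi pulse_root_nonzero power_int_minus flip: prod.distrib)

lemma adj_pulse: "adj (pulse b) ** pulse b = mat 1" "pulse b ** adj (pulse b) = mat 1"
  using pulse_phase_cnj[of b]
  by (simp_all add: pulse_eq adj_diag_mat diag_mat_mult mat_eq_diag_mat mult.commute)

section \<open>Hopping terms under conjugation\<close>

definition hop_phase :: "int^'n \<Rightarrow> 'n \<Rightarrow> 'n \<Rightarrow> complex"
  where "hop_phase b j k = pulse_root powi (b $ k - b $ j)"

lemma hop_phase_swap: "hop_phase b k j = cnj (hop_phase b j k)"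
  by (simp add: hop_phase_def cnj_pulse_root_powi)

text \<open>An entry is nonzero only if \<open>T\<close> arises from \<open>S\<close> by moving one
  particle from \<open>k\<close> to \<open>j\<close>. The phases of the modes common to both cancel,
  which leaves those of \<open>j\<close> and \<open>k\<close> for every such pair of sets.\<close>

lemma conjugate_hopping:
  assumes "j \<noteq> k"
  shows "adj (pulse b) ** (create j ** annihilate k) ** pulse b
    = hop_phase b j k *\<^sub>C (create j ** annihilate k)"
proof -
  have "cnj (pulse_phase b T) * (create j ** annihilate k) $ T $ S * pulse_phase b S
      = hop_phase b j k * (create j ** annihilate k) $ T $ S" for T S
  proof (cases "j \<in> T \<and> k \<notin> T - {j} \<and> S = insert k (T - {j})")
    case True
    define R where "R = T - {j}"
    have T: "T = insert j R" "j \<notin> R" and S: "S = insert k R" "k \<notin> R"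
      using True by (auto simp: R_def)
    have "cnj (pulse_phase b T) * pulse_phase b S
        = (pulse_root powi (- (b $ j)) * pulse_root powi (b $ k)) * (cnj (pulse_phase b R) * pulse_phase b R)"
      using T S by (simp add: pulse_phase_def cnj_pulse_root_powi)
    also have "\<dots> = hop_phase b j k"
      by (simp add: pulse_phase_cnj hop_phase_def pulse_root_nonzero flip: power_int_add)
    finally show ?thesis by (simp add: mult_ac)
  next
    case False
    then have "(create j ** annihilate k) $ T $ S = 0"
      by (auto simp: create_mult_entry annihilate_entry)
    then show ?thesis by simp
  qed
  then show ?thesis
    by (simp add: vec_eq_iff pulse_eq adj_diag_mat mult_diag_mat_entry diag_mat_mult_entry cscale_def)
qed

lemma cscale_matrix_mult: "(c *\<^sub>C A) ** B = c *\<^sub>C (A ** B)" "A ** (c *\<^sub>C B) = c *\<^sub>C (A ** B)"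
  by (simp_all add: cscale_def matrix_matrix_mult_def vec_eq_iff sum_distrib_left mult_ac)

lemma cscale_add: "c *\<^sub>C (A + B) = c *\<^sub>C A + c *\<^sub>C B"
  by (simp add: cscale_def vec_eq_iff algebra_simps)

lemma cscale_cscale: "c *\<^sub>C d *\<^sub>C A = (c * d) *\<^sub>C A"
  by (simp add: cscale_def vec_eq_iff algebra_simps)

lemma cscale_sum: "c *\<^sub>C sum f I = (\<Sum>i\<in>I. c *\<^sub>C f i)"
  by (induction I rule: infinite_finite_induct) (simp_all add: cscale_add, simp_all add: cscale_def vec_eq_iff)

lemma conjugate_sum: "A ** sum f I ** B = (\<Sum>i\<in>I. A ** f i ** (B :: complex^'m^'m))"
  by (induction I rule: infinite_finite_induct) (simp_all add: matrix_add_ldistrib matrix_add_rdistrib)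

text \<open>The two hopping directions of an edge acquire conjugate phases, so the result again has
  the form of a target Hamiltonian.\<close>

lemma conjugate_system_hamiltonian:
  "adj (pulse b) ** system_hamiltonian \<alpha> E ** pulse b
    = target_hamiltonian (\<lambda>j k. of_real \<alpha> * hop_phase b j k) E"
  unfolding system_hamiltonian_def target_hamiltonian_def cscale_matrix_mult conjugate_sum cscale_sum
proof (rule sum.cong, goal_cases)
  case (2 p)
  obtain j k where p: "p = (j, k)" "j \<noteq> k" using 2 by auto
  then show ?case
    using hop_phase_swap[of b j k]
    by (simp add: matrix_add_ldistrib matrix_add_rdistrib conjugate_hopping cscale_add cscale_cscale)
qed simp

text \<open>Each weight also enters conjugated, through the reverse hopping term, so the Hamiltonian
  is linear in its weights only over the reals; hence the real coefficients
  \<open>c\<close>.\<close>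

lemma sum_scaleR_target_hamiltonian:
  "(\<Sum>\<mu>\<in>M. c \<mu> *\<^sub>R target_hamiltonian (\<gamma> \<mu>) E)
    = target_hamiltonian (\<lambda>j k. \<Sum>\<mu>\<in>M. of_real (c \<mu>) * \<gamma> \<mu> j k) E"
proof -
  have cs: "c *\<^sub>R A = complex_of_real c *\<^sub>C A" for c and A :: "complex^'m^'m"
    by (simp add: cscale_def vec_eq_iff, simp add: scaleR_conv_of_real)
  have sum_cs: "(\<Sum>\<mu>\<in>M. f \<mu> *\<^sub>C A) = sum f M *\<^sub>C A" for f and A :: "complex^'m^'m"
    by (simp add: cscale_def vec_eq_iff sum_distrib_right)
  show ?thesis
    unfolding target_hamiltonian_def cs cscale_sum
    by (subst sum.swap, rule sum.cong)
      (auto simp: cscale_add cscale_cscale sum.distrib sum_cs)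
qed

section \<open>Nonnegative combinations of phase vectors\<close>

text \<open>If there are more vectors than generators of the ambient space, subtract a multiple of a linear
  relation from the coefficients until one of them vanishes.\<close>

lemma conic_caratheodory:
  fixes v :: "'i \<Rightarrow> 'a::real_vector"
  assumes "finite I" "finite T" "\<And>i. i \<in> I \<Longrightarrow> 0 \<le> c i" "\<And>i. i \<in> I \<Longrightarrow> v i \<in> span T"
  shows "\<exists>J c'. J \<subseteq> I \<and> card J \<le> card T \<and> (\<forall>i\<in>J. 0 \<le> c' i) \<and>
    (\<Sum>i\<in>J. c' i *\<^sub>R v i) = (\<Sum>i\<in>I. c i *\<^sub>R v i)"
  using assms
proof (induction "card I" arbitrary: I c)
  case 0
  then show ?case by auto
next
  case (Suc n)
  show ?case
  proof (cases "card I \<le> card T")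
    case True
    then show ?thesis using Suc.prems by blast
  next
    case False
    have "\<exists>d. (\<exists>i\<in>I. d i > 0) \<and> (\<Sum>i\<in>I. d i *\<^sub>R v i) = 0"
    \<comment> \<open>\<open>dependent\<close> speaks of a set of vectors and does not see
      repetitions. If two indices carry the same vector, their difference is the relation.\<close>
    proof (cases "inj_on v I")
      case True
      then have "card (v ` I) > card T" using False by (simp add: card_image)
      then have "dependent (v ` I)"
        using independent_span_bound[OF \<open>finite T\<close>, of "v ` I"] Suc.prems by fastforce
      then obtain u where u: "\<exists>x\<in>v ` I. u x \<noteq> 0" "(\<Sum>x\<in>v ` I. u x *\<^sub>R x) = 0"
        using dependent_finite[of "v ` I"] Suc.prems by auto
      then obtain i where i: "i \<in> I" "u (v i) \<noteq> 0" by auto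
      have sum0: "(\<Sum>i\<in>I. u (v i) *\<^sub>R v i) = 0"
        using u(2) True by (simp add: sum.reindex)
      show ?thesis
      \<comment> \<open>A relation may be negated, so some coefficient can be assumed
        positive.\<close>
      proof (cases "u (v i) > 0")
        case True
        then show ?thesis using i sum0 by (intro exI[of _ "\<lambda>i. u (v i)"]) auto
      next
        case False
        then show ?thesis using i sum0
          by (intro exI[of _ "\<lambda>i. - u (v i)"]) (auto simp: sum_negf intro!: bexI[of _ i])
      qed
    next
      case False
      then obtain i j where ij: "i \<in> I" "j \<in> I" "i \<noteq> j" "v i = v j"
        by (auto simp: inj_on_def)
      define d where "d k = (if k = i then 1 else 0) - (if k = j then 1 else (0::real))" for k
      have "(\<Sum>k\<in>I. d k *\<^sub>R v k) = (\<Sum>k\<in>I. (if k = i then v i else 0) - (if k = j then v j else 0))"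
        by (intro sum.cong) (auto simp: d_def)
      also have "\<dots> = 0" using ij Suc.prems by (simp add: sum_subtractf)
      finally show ?thesis using ij by (intro exI[of _ d]) (auto simp: d_def intro!: bexI[of _ i])
    qed
    then obtain d i0 where d: "i0 \<in> I" "d i0 > 0" "(\<Sum>i\<in>I. d i *\<^sub>R v i) = 0" by blast
    define P where "P = {i \<in> I. d i > 0}"
    have P: "finite P" "P \<noteq> {}" using d Suc.prems by (auto simp: P_def)
    \<comment> \<open>The largest multiple of the relation that can be subtracted while all
      coefficients stay nonnegative. An index attaining the minimum ends with coefficient 0 and is
      dropped.\<close>
    define q where "q = Min ((\<lambda>i. c i / d i) ` P)"
    have "q \<in> (\<lambda>i. c i / d i) ` P" unfolding q_def using P by (intro Min_in) auto
    then obtain m where m: "m \<in> P" "q = c m / d m" by auto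
    have mI: "m \<in> I" "d m > 0" using m by (auto simp: P_def)
    have q0: "q \<ge> 0" using mI m Suc.prems by simp
    define c' where "c' i = c i - q * d i" for i
    have nonneg: "0 \<le> c' i" if "i \<in> I" for i
    proof (cases "d i > 0")
      case True
      then have "q \<le> c i / d i" unfolding q_def using that P by (intro Min_le) (auto simp: P_def)
      then show ?thesis using True by (simp add: c'_def field_simps)
    next
      case False
      then have "q * d i \<le> 0" using q0 by (simp add: mult_nonneg_nonpos)
      moreover have "0 \<le> c i" using that Suc.prems by simp
      ultimately show ?thesis by (simp add: c'_def)
    qed
    have "c' m = 0" using mI m by (simp add: c'_def)
    then have "(\<Sum>i\<in>I - {m}. c' i *\<^sub>R v i) = (\<Sum>i\<in>I. c' i *\<^sub>R v i)"
      using mI Suc.prems by (intro sum.mono_neutral_left) auto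
    also have "\<dots> = (\<Sum>i\<in>I. c i *\<^sub>R v i) - q *\<^sub>R (\<Sum>i\<in>I. d i *\<^sub>R v i)"
      by (simp add: c'_def algebra_simps sum_subtractf scaleR_sum_right)
    finally have eq: "(\<Sum>i\<in>I - {m}. c' i *\<^sub>R v i) = (\<Sum>i\<in>I. c i *\<^sub>R v i)" using d by simp
    have "n = card (I - {m})" using Suc.hyps(2) mI by simp
    from Suc.hyps(1)[OF this, of c'] show ?thesis
      using Suc.prems nonneg eq by fastforce
  qed
qed

section \<open>Orthogonality of characters modulo 3\<close>

lemma pulse_root_powi_eq_1_iff: "pulse_root powi k = 1 \<longleftrightarrow> 3 dvd k"
proof -
  have "pulse_root powi k = exp (- (2 * of_real pi * \<i> / 3) * of_int k)"
    unfolding pulse_root_def by (simp add: exp_power_int mult.commute)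
  also have "\<dots> = 1 \<longleftrightarrow> (\<exists>n::int. - (2 * pi / 3 * k) = of_int (2 * n) * pi)"
    by (subst exp_eq_1) simp
  also have "\<dots> \<longleftrightarrow> (\<exists>n::int. - k = 3 * n)"
  proof (intro ex_cong1)
    fix n :: int
    have "- (2 * pi / 3 * k) = of_int (2 * n) * pi \<longleftrightarrow> (2 * pi) * of_int (- k) = (2 * pi) * of_int (3 * n)"
      by (auto simp: field_simps)
    also have "\<dots> \<longleftrightarrow> - k = 3 * n"
      by (simp only: mult_cancel_left of_int_eq_iff) simp
    finally show "- (2 * pi / 3 * k) = of_int (2 * n) * pi \<longleftrightarrow> - k = 3 * n" .
  qed
  also have "\<dots> \<longleftrightarrow> 3 dvd k"
    by (metis dvd_def dvd_minus_iff)
  finally show ?thesis .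
qed

text \<open>The number \<open>z = pulse_root powi k\<close> is a root of \<open>z^3 - 1\<close>
  other than 1, hence a root of \<open>1 + z + z^2\<close>.\<close>

lemma pulse_root_sum:
  assumes "\<not> 3 dvd k"
  shows "(\<Sum>y\<in>{0,1,2}. pulse_root powi (k * y)) = 0"
proof -
  define z where "z = pulse_root powi k"
  have "z \<noteq> 1" using assms by (simp add: z_def pulse_root_powi_eq_1_iff)
  have "z powi 3 = pulse_root powi (k * 3)" unfolding z_def by (rule power_int_mult[symmetric])
  also have "\<dots> = 1" by (simp add: pulse_root_powi_eq_1_iff)
  finally have "(z - 1) * (1 + z + z ^ 2) = 0"
    by (simp add: algebra_simps power2_eq_square power3_eq_cube)
  then have "1 + z + z ^ 2 = 0" using \<open>z \<noteq> 1\<close> by simp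
  then show ?thesis by (simp add: power_int_mult z_def add.assoc)
qed

text \<open>Phases depend on \<open>b\<close> only modulo 3, so these representatives of the residue
  classes form a finite group to average over.\<close>

definition pulse_vectors :: "(int^'n) set"
  where "pulse_vectors = {b. \<forall>x. b $ x \<in> {0,1,2}}"

lemma pulse_vectors_eq: "pulse_vectors = vec_lambda ` PiE UNIV (\<lambda>_. {0,1,2})"
proof -
  have "b \<in> vec_lambda ` PiE UNIV (\<lambda>_. {0,1,2})" if "b \<in> pulse_vectors" for b :: "int^'n"
    using that by (intro image_eqI[of _ _ "vec_nth b"]) (auto simp: pulse_vectors_def)
  then show ?thesis by (force simp: pulse_vectors_def PiE_iff)
qed

lemma finite_pulse_vectors: "finite (pulse_vectors :: (int^'n) set)"
  unfolding pulse_vectors_eq by (intro finite_imageI finite_PiE) auto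

lemma pulse_vectors_nonempty: "pulse_vectors \<noteq> {}"
  by (auto simp: pulse_vectors_def intro!: exI[of _ 0])

text \<open>The sum factors into one sum per mode, and the factor of mode \<open>x\<close>
  vanishes.\<close>

lemma sum_pulse_vectors:
  assumes "\<not> 3 dvd m $ x"
  shows "(\<Sum>b\<in>pulse_vectors. pulse_root powi (\<Sum>x\<in>UNIV. m $ x * b $ x)) = 0"
proof -
  have powi_sum: "pulse_root powi (sum f X) = (\<Prod>x\<in>X. pulse_root powi f x)" for f and X :: "'a set"
    by (induction X rule: infinite_finite_induct) (simp_all add: power_int_add pulse_root_nonzero)
  have "(\<Sum>b\<in>pulse_vectors. pulse_root powi (\<Sum>x\<in>UNIV. m $ x * b $ x))
      = (\<Sum>g\<in>PiE UNIV (\<lambda>_. {0,1,2}). \<Prod>x\<in>UNIV. pulse_root powi (m $ x * g x))"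
    unfolding pulse_vectors_eq
    by (subst sum.reindex) (auto simp: inj_on_def powi_sum vec_lambda_inject)
  also have "\<dots> = (\<Prod>x\<in>UNIV. \<Sum>y\<in>{0,1,2}. pulse_root powi (m $ x * y))"
    by (rule prod_sum_PiE[symmetric]) auto
  also have "\<dots> = 0"
    using pulse_root_sum[OF assms] by (intro prod_zero) auto
  finally show ?thesis .
qed

lemma sum_hop_phase:
  assumes "j \<noteq> k"
  shows "(\<Sum>b\<in>pulse_vectors. hop_phase b j k) = 0"
proof -
  have "(\<Sum>x\<in>UNIV. (axis k 1 - axis j 1) $ x * b $ x) = b $ k - b $ j" for b :: "int^'a"
    by (simp add: axis_def left_diff_distrib sum_subtractf if_distrib[of "\<lambda>x. x * _"] cong: if_cong)
  moreover have "\<not> 3 dvd (axis k 1 - axis j 1 :: int^'a) $ k" using assms by (simp add: axis_def)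
  ultimately show ?thesis
    unfolding hop_phase_def by (metis (no_types, lifting) sum.cong sum_pulse_vectors)
qed

text \<open>The only excluded pair is the reversed one, where the product is constantly 1. The case
  \<open>(j', k') = (j, k)\<close> is included because the square of a hopping character is
  nontrivial modulo 3; modulo 2 this would fail.\<close>

lemma sum_hop_phase_mult:
  assumes "j \<noteq> k" "j' \<noteq> k'" "(j', k') \<noteq> (k, j)"
  shows "(\<Sum>b\<in>pulse_vectors. hop_phase b j k * hop_phase b j' k') = 0"
proof -
  define m :: "int^'a" where "m = axis k 1 - axis j 1 + (axis k' 1 - axis j' 1)"
  have "hop_phase b j k * hop_phase b j' k' = pulse_root powi (\<Sum>x\<in>UNIV. m $ x * b $ x)" for b
    by (simp add: hop_phase_def pulse_root_nonzero m_def axis_def distrib_right left_diff_distrib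
        sum.distrib sum_subtractf if_distrib[of "\<lambda>x. x * _"] flip: power_int_add cong: if_cong)
  \<comment> \<open>The entry at \<open>k\<close> lies in {0, 1, 2} and is 0 only if
    \<open>j' = k\<close>; the entry at \<open>j\<close> lies in {-2, -1, 0} and is 0 only if
    \<open>k' = j\<close>.\<close>
  moreover have "\<not> 3 dvd m $ k \<or> \<not> 3 dvd m $ j"
    using assms by (auto simp: m_def axis_def)
  ultimately show ?thesis by (auto simp: sum_pulse_vectors)
qed

lemma norm_hop_phase: "norm (hop_phase b j k) = 1"
  by (simp add: hop_phase_def pulse_root_def norm_power_int)

lemma hop_phase_cnj: "cnj (hop_phase b j k) * hop_phase b j k = 1"
  using complex_norm_square[of "hop_phase b j k"] by (simp add: norm_hop_phase mult.commute)

text \<open>The coefficients come from inverting the Fourier transform on \<open>(\<int>/3)\<^sup>n\<close>: the characters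
  \<open>hop_phase b j k\<close> and their conjugates are pairwise distinct and nontrivial, and nontriviality allows
  adding a constant to all weights to make them nonnegative.\<close>

lemma hop_phase_combination:
  fixes P :: "('n::finite \<times> 'n) set" and \<gamma> :: "'n \<Rightarrow> 'n \<Rightarrow> complex"
  assumes P: "\<And>j k. (j, k) \<in> P \<Longrightarrow> (k, j) \<notin> P"
  shows "\<exists>c. (\<forall>b. 0 \<le> c b) \<and>
    (\<forall>j k. (j, k) \<in> P \<longrightarrow> (\<Sum>b\<in>pulse_vectors. of_real (c b) * hop_phase b j k) = \<gamma> j k)"
proof -
  define M where "M = real (card (pulse_vectors :: (int^'n) set))"
  have M: "M > 0"
    unfolding M_def using finite_pulse_vectors pulse_vectors_nonempty by (simp add: card_gt_0_iff)
  \<comment> \<open>Fourier inversion: the character of an edge and its conjugate receive conjugate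
    coefficients, so each pair adds up to twice a real part and the weight is real.\<close>
  define w where "w b = (\<Sum>(j, k)\<in>P. 2 * Re (\<gamma> j k * cnj (hop_phase b j k))) / M" for b
  \<comment> \<open>The phases have modulus 1, so \<open>w b\<close> is at least
    \<open>- C\<close>.\<close>
  define C where "C = (\<Sum>(j, k)\<in>P. 2 * norm (\<gamma> j k)) / M"
  have "0 \<le> C + w b" for b
  proof -
    have "- (2 * norm (\<gamma> j k)) \<le> 2 * Re (\<gamma> j k * cnj (hop_phase b j k))" for j k
    proof -
      have "\<bar>Re (\<gamma> j k * cnj (hop_phase b j k))\<bar> \<le> norm (\<gamma> j k)"
        using abs_Re_le_cmod[of "\<gamma> j k * cnj (hop_phase b j k)"]
        by (simp add: norm_mult norm_hop_phase)
      then show ?thesis by linarith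
    qed
    then have "(\<Sum>(j, k)\<in>P. - (2 * norm (\<gamma> j k))) \<le> (\<Sum>(j, k)\<in>P. 2 * Re (\<gamma> j k * cnj (hop_phase b j k)))"
      by (intro sum_mono) auto
    then have "0 \<le> (\<Sum>(j, k)\<in>P. 2 * norm (\<gamma> j k)) + (\<Sum>(j, k)\<in>P. 2 * Re (\<gamma> j k * cnj (hop_phase b j k)))"
      by (simp add: case_prod_beta sum_negf)
    then show ?thesis
      using M by (simp add: C_def w_def flip: add_divide_distrib)
  qed
  moreover have "(\<Sum>b\<in>pulse_vectors. of_real (C + w b) * hop_phase b j k) = \<gamma> j k" if jk: "(j, k) \<in> P" for j k
  proof -
    have ne: "j \<noteq> k" using P[OF jk] jk by auto
    have "(\<Sum>b\<in>pulse_vectors. of_real (C + w b) * hop_phase b j k)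
        = of_real C * (\<Sum>b\<in>pulse_vectors. hop_phase b j k)
          + (\<Sum>b\<in>pulse_vectors. of_real (w b) * hop_phase b j k)"
      by (simp add: distrib_right sum.distrib sum_distrib_left)
    also have "\<dots> = (\<Sum>b\<in>pulse_vectors. of_real (w b) * hop_phase b j k)"
      using ne by (simp add: sum_hop_phase)
    also have "\<dots> = (\<Sum>b\<in>pulse_vectors. \<Sum>(j', k')\<in>P. (\<gamma> j' k' / M) * (hop_phase b k' j' * hop_phase b j k)
          + (cnj (\<gamma> j' k') / M) * (hop_phase b j' k' * hop_phase b j k))"
    proof (rule sum.cong[OF refl])
      fix b :: "int^'n"
      have re: "complex_of_real (2 * Re z) = z + cnj z" for z by (simp add: complex_add_cnj)
      have "of_real (w b) = (\<Sum>(j', k')\<in>P. \<gamma> j' k' * hop_phase b k' j' + cnj (\<gamma> j' k') * hop_phase b j' k') / of_real M"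
        unfolding w_def of_real_divide of_real_sum
        by (intro arg_cong2[where f = "(/)"] sum.cong refl)
          (simp only: case_prod_beta re complex_cnj_mult complex_cnj_cnj hop_phase_swap[symmetric])
      then show "of_real (w b) * hop_phase b j k = (\<Sum>(j', k')\<in>P. (\<gamma> j' k' / M) * (hop_phase b k' j' * hop_phase b j k)
          + (cnj (\<gamma> j' k') / M) * (hop_phase b j' k' * hop_phase b j k))"
        by (simp add: sum_divide_distrib sum_distrib_right case_prod_beta distrib_right add_divide_distrib mult.assoc)
    qed
    also have "\<dots> = (\<Sum>(j', k')\<in>P. (\<gamma> j' k' / M) * (\<Sum>b\<in>pulse_vectors. hop_phase b k' j' * hop_phase b j k)
          + (cnj (\<gamma> j' k') / M) * (\<Sum>b\<in>pulse_vectors. hop_phase b j' k' * hop_phase b j k))"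
      by (subst sum.swap) (simp add: case_prod_beta sum.distrib sum_distrib_left)
    also have "\<dots> = (\<Sum>p\<in>P. if p = (j, k) then \<gamma> j k else 0)"
    proof (rule sum.cong[OF refl])
      fix p assume p: "p \<in> P"
      obtain j' k' where p': "p = (j', k')" by (cases p)
      \<comment> \<open>\<open>P\<close> contains no edge in both directions, so the conjugate
        characters never match \<open>(j, k)\<close>. The other family matches only at
        \<open>p = (j, k)\<close>, where each product of phases is 1.\<close>
      have ne': "j' \<noteq> k'" "(j, k) \<noteq> (k', j')" using P p jk p' by auto
      have "(\<Sum>b\<in>pulse_vectors. hop_phase b j' k' * hop_phase b j k) = 0"
        using ne ne' by (intro sum_hop_phase_mult) auto
      moreover have "(\<Sum>b\<in>pulse_vectors. hop_phase b k' j' * hop_phase b j k) = (if p = (j, k) then of_real M else 0)"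
      proof (cases "p = (j, k)")
        case True
        then show ?thesis
          using p' by (simp add: hop_phase_swap[of _ k j] hop_phase_cnj M_def)
      next
        case False
        then have "(\<Sum>b\<in>pulse_vectors. hop_phase b k' j' * hop_phase b j k) = 0"
          using ne ne' p' by (intro sum_hop_phase_mult) auto
        then show ?thesis using False by simp
      qed
      ultimately show "(case p of (j', k') \<Rightarrow>
          (\<gamma> j' k' / M) * (\<Sum>b\<in>pulse_vectors. hop_phase b k' j' * hop_phase b j k)
          + (cnj (\<gamma> j' k') / M) * (\<Sum>b\<in>pulse_vectors. hop_phase b j' k' * hop_phase b j k))
          = (if p = (j, k) then \<gamma> j k else 0)"
        using M p' by auto
    qed
    also have "\<dots> = \<gamma> j k" using jk by simp
    finally show ?thesis .
  qed
  ultimately show ?thesis by (intro exI[of _ "\<lambda>b. C + w b"]) auto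
qed

text \<open>The phase vectors lie in a real space of dimension \<open>2 * card P\<close>, two real
  coordinates per edge; this is the source of the number \<open>2r\<close> of pulses.\<close>

lemma hop_phase_sparse_combination:
  fixes P :: "('n::finite \<times> 'n) set" and \<gamma> :: "'n \<Rightarrow> 'n \<Rightarrow> complex"
  assumes P: "\<And>j k. (j, k) \<in> P \<Longrightarrow> (k, j) \<notin> P"
  shows "\<exists>(b :: nat \<Rightarrow> int^'n) lam. (\<forall>\<mu>. 0 \<le> lam \<mu>) \<and>
    (\<forall>j k. (j, k) \<in> P \<longrightarrow> (\<Sum>\<mu>\<in>{1..2 * card P}. of_real (lam \<mu>) * hop_phase (b \<mu>) j k) = \<gamma> j k)"
proof -
  obtain c where c: "\<And>b. 0 \<le> c b"
    "\<And>j k. (j, k) \<in> P \<Longrightarrow> (\<Sum>b\<in>pulse_vectors. of_real (c b) * hop_phase b j k) = \<gamma> j k"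
    using hop_phase_combination[of P \<gamma>] P by blast
  define v :: "int^'n \<Rightarrow> complex^('n \<times> 'n)"
    where "v b = (\<chi> p. if p \<in> P then hop_phase b (fst p) (snd p) else 0)" for b
  \<comment> \<open>\<open>span\<close> takes real coefficients, so each coordinate in
    \<open>P\<close> needs a real and an imaginary direction. Coordinates outside \<open>P\<close>
    were set to 0 in \<open>v\<close> and need none.\<close>
  define T :: "(complex^('n \<times> 'n)) set" where "T = (\<lambda>p. axis p 1) ` P \<union> (\<lambda>p. axis p \<i>) ` P"
  have fT: "finite T" by (simp add: T_def)
  have "card T \<le> card ((\<lambda>p. axis p 1 :: complex^('n \<times> 'n)) ` P) + card ((\<lambda>p. axis p \<i> :: complex^('n \<times> 'n)) ` P)"
    unfolding T_def by (rule card_Un_le)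
  also have "\<dots> \<le> card P + card P" by (intro add_mono card_image_le) auto
  finally have cT: "card T \<le> 2 * card P" by simp
  have vT: "v b \<in> span T" for b
  proof -
    have "v b = (\<Sum>p\<in>P. Re (v b $ p) *\<^sub>R axis p 1 + Im (v b $ p) *\<^sub>R axis p \<i>)"
    proof (subst vec_eq_iff, rule allI)
      fix q
      have "(\<Sum>p\<in>P. Re (v b $ p) *\<^sub>R axis p 1 + Im (v b $ p) *\<^sub>R axis p \<i>) $ q
          = (\<Sum>p\<in>P. if p = q then v b $ q else 0)"
        unfolding sum_component
        by (intro sum.cong) (auto simp: axis_def complex_eq_iff)
      also have "\<dots> = v b $ q" by (simp add: v_def)
      finally show "v b $ q = (\<Sum>p\<in>P. Re (v b $ p) *\<^sub>R axis p 1 + Im (v b $ p) *\<^sub>R axis p \<i>) $ q" by simp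
    qed
    also have "\<dots> \<in> span T"
      by (intro span_sum span_add span_scale span_base) (auto simp: T_def)
    finally show ?thesis .
  qed
  obtain J c' where J: "J \<subseteq> pulse_vectors" "card J \<le> card T" "\<forall>b\<in>J. 0 \<le> c' b"
    "(\<Sum>b\<in>J. c' b *\<^sub>R v b) = (\<Sum>b\<in>pulse_vectors. c b *\<^sub>R v b)"
    using conic_caratheodory[OF finite_pulse_vectors fT, of c v] c(1) vT by blast
  have "finite J" using J(1) finite_pulse_vectors by (rule finite_subset)
  then obtain h where h: "bij_betw h {1..card J} J" using ex_bij_betw_nat_finite_1 by blast
  \<comment> \<open>\<open>J\<close> may have fewer than \<open>2 * card P\<close> elements; the
    surplus indices get duration 0, so the value of \<open>h\<close> there does not matter.\<close>
  define lam where "lam \<mu> = (if \<mu> \<in> {1..card J} then c' (h \<mu>) else 0)" for \<mu>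
  have "0 \<le> lam \<mu>" for \<mu>
    using J(3) bij_betwE[OF h] by (auto simp: lam_def)
  moreover have "(\<Sum>\<mu>\<in>{1..2 * card P}. of_real (lam \<mu>) * hop_phase (h \<mu>) j k) = \<gamma> j k" if jk: "(j, k) \<in> P" for j k
  proof -
    have "(\<Sum>\<mu>\<in>{1..2 * card P}. of_real (lam \<mu>) * hop_phase (h \<mu>) j k)
        = (\<Sum>\<mu>\<in>{1..card J}. of_real (c' (h \<mu>)) * hop_phase (h \<mu>) j k)"
      using J(2) cT by (intro sum.mono_neutral_cong_right) (auto simp: lam_def)
    also have "\<dots> = (\<Sum>b\<in>J. of_real (c' b) * hop_phase b j k)"
      by (rule sum.reindex_bij_betw[OF h])
    also have "\<dots> = (\<Sum>b\<in>J. c' b *\<^sub>R v b) $ (j, k)"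
      using jk by (simp add: sum_component v_def, simp add: scaleR_conv_of_real)
    also have "\<dots> = (\<Sum>b\<in>pulse_vectors. of_real (c b) * hop_phase b j k)"
      unfolding J(4) using jk by (simp add: sum_component v_def, simp add: scaleR_conv_of_real)
    also have "\<dots> = \<gamma> j k" by (rule c(2)[OF jk])
    finally show ?thesis .
  qed
  ultimately show ?thesis by blast
qed

section \<open>Simulation of the target Hamiltonian\<close>

text \<open>Each edge has exactly one increasing listing, its minimum followed by its
  maximum.\<close>

lemma card_ordered_edges:
  fixes E :: "'n::{finite,linorder} set set"
  assumes "\<forall>e\<in>E. card e = 2"
  shows "card {(j, k). j < k \<and> {j, k} \<in> E} = card E"
proof -
  have "bij_betw (\<lambda>(j, k). {j, k}) {(j, k). j < k \<and> {j, k} \<in> E} E"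
  proof (rule bij_betwI')
    fix p q :: "'n \<times> 'n"
    assume "p \<in> {(j, k). j < k \<and> {j, k} \<in> E}" "q \<in> {(j, k). j < k \<and> {j, k} \<in> E}"
    then show "(case p of (j, k) \<Rightarrow> {j, k}) = (case q of (j, k) \<Rightarrow> {j, k}) \<longleftrightarrow> p = q"
      by (auto simp: doubleton_eq_iff)
  next
    fix e assume e: "e \<in> E"
    then obtain x y where xy: "e = {x, y}" "x \<noteq> y" using assms card_2_iff by metis
    then show "\<exists>p\<in>{(j, k). j < k \<and> {j, k} \<in> E}. e = (case p of (j, k) \<Rightarrow> {j, k})"
      using e by (intro bexI[of _ "(min x y, max x y)"]) (auto simp: min_def max_def insert_commute)
  qed auto
  then show ?thesis by (rule bij_betw_same_card)
qed

theorem theorem1: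
  fixes E\<^sub>S E\<^sub>T :: "'n::{finite,linorder} set set"
    and \<alpha> :: real and \<beta> :: "'n::{finite,linorder} \<Rightarrow> 'n \<Rightarrow> complex" and r :: nat
  assumes "E\<^sub>T \<subseteq> E\<^sub>S" and "\<forall>e\<in>E\<^sub>S. card e = 2" and "r = card E\<^sub>S" and "\<alpha> \<noteq> 0"
  shows "\<exists>(b :: nat \<Rightarrow> int^'n::{finite,linorder}) (lam :: nat \<Rightarrow> real).
    (\<forall>\<mu>\<in>{1..2*r}. 0 \<le> lam \<mu>) \<and>
    (\<forall>t::real.
      (\<lambda>N. mpow
        (mprod_list (map (\<lambda>\<mu>. adj (pulse (b \<mu>)) **
            evolution (system_hamiltonian \<alpha> E\<^sub>S) (lam \<mu> * t / real N) ** pulse (b \<mu>))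
          [1..<2*r+1])) N)
      \<longlonglongrightarrow> evolution (target_hamiltonian \<beta> E\<^sub>T) t)"
proof -
  define P where "P = {(j, k). j < k \<and> {j, k} \<in> E\<^sub>S}"
  have r: "r = card P"
    unfolding P_def assms(3) by (rule card_ordered_edges[OF assms(2), symmetric])
  \<comment> \<open>Dividing by \<alpha> compensates the coupling of the system, and the value 0
    switches off the edges outside \<open>E\<^sub>T\<close>.\<close>
  define \<gamma> where "\<gamma> j k = (if {j, k} \<in> E\<^sub>T then \<beta> j k / of_real \<alpha> else 0)" for j k
  have "\<exists>(b :: nat \<Rightarrow> int^'n::{finite,linorder}) lam. (\<forall>\<mu>. 0 \<le> lam \<mu>) \<and>
      (\<forall>j k. (j, k) \<in> P \<longrightarrow>
        (\<Sum>\<mu>\<in>{1..2 * r}. of_real (lam \<mu>) * hop_phase (b \<mu>) j k) = \<gamma> j k)"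
    unfolding r by (rule hop_phase_sparse_combination) (auto simp: P_def)
  then obtain b :: "nat \<Rightarrow> int^'n::{finite,linorder}" and lam where lam: "\<And>\<mu>. 0 \<le> lam \<mu>"
    "\<And>j k. (j, k) \<in> P \<Longrightarrow>
      (\<Sum>\<mu>\<in>{1..2 * r}. of_real (lam \<mu>) * hop_phase (b \<mu>) j k) = \<gamma> j k"
    by blast
  define H where "H \<mu> = target_hamiltonian (\<lambda>j k. of_real \<alpha> * hop_phase (b \<mu>) j k) E\<^sub>S" for \<mu>
  have "(\<Sum>\<mu>\<in>{1..2 * r}. lam \<mu> *\<^sub>R H \<mu>)
      = target_hamiltonian (\<lambda>j k. \<Sum>\<mu>\<in>{1..2 * r}. of_real (lam \<mu>) * (of_real \<alpha> * hop_phase (b \<mu>) j k)) E\<^sub>S"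
    unfolding H_def by (rule sum_scaleR_target_hamiltonian)
  also have "\<dots> = (\<Sum>(j, k)\<in>P. if {j, k} \<in> E\<^sub>T then \<beta> j k *\<^sub>C (create j ** annihilate k)
      + cnj (\<beta> j k) *\<^sub>C (create k ** annihilate j) else 0)"
    unfolding target_hamiltonian_def P_def[symmetric]
  proof (rule sum.cong[OF refl], clarify)
    fix j k assume jk: "(j, k) \<in> P"
    have "(\<Sum>\<mu>\<in>{1..2 * r}. of_real (lam \<mu>) * (of_real \<alpha> * hop_phase (b \<mu>) j k))
        = of_real \<alpha> * (\<Sum>\<mu>\<in>{1..2 * r}. of_real (lam \<mu>) * hop_phase (b \<mu>) j k)"
      by (simp add: sum_distrib_left mult_ac)
    also have "\<dots> = (if {j, k} \<in> E\<^sub>T then \<beta> j k else 0)"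
      unfolding lam(2)[OF jk] \<gamma>_def using assms(4) by simp
    finally have *: "(\<Sum>\<mu>\<in>{1..2 * r}. of_real (lam \<mu>) * (of_real \<alpha> * hop_phase (b \<mu>) j k))
        = (if {j, k} \<in> E\<^sub>T then \<beta> j k else 0)" .
    have zero: "0 *\<^sub>C A = 0" for A :: "complex^('n set)^('n set)"
      by (simp add: cscale_def vec_eq_iff)
    show "(\<Sum>\<mu>\<in>{1..2 * r}. of_real (lam \<mu>) * (of_real \<alpha> * hop_phase (b \<mu>) j k)) *\<^sub>C (create j ** annihilate k)
        + cnj (\<Sum>\<mu>\<in>{1..2 * r}. of_real (lam \<mu>) * (of_real \<alpha> * hop_phase (b \<mu>) j k)) *\<^sub>C (create k ** annihilate j)
      = (if {j, k} \<in> E\<^sub>T then \<beta> j k *\<^sub>C (create j ** annihilate k)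
      + cnj (\<beta> j k) *\<^sub>C (create k ** annihilate j) else 0)"
      unfolding * by (simp add: zero)
  qed
  also have "\<dots> = target_hamiltonian \<beta> E\<^sub>T"
    unfolding target_hamiltonian_def P_def using assms(1)
    by (intro sum.mono_neutral_cong_right) (auto split: if_splits)
  finally have sumH: "(\<Sum>\<mu>\<in>{1..2 * r}. lam \<mu> *\<^sub>R H \<mu>) = target_hamiltonian \<beta> E\<^sub>T" .
  have "(\<lambda>N. mpow (mprod_list (map (\<lambda>\<mu>. adj (pulse (b \<mu>)) **
          evolution (system_hamiltonian \<alpha> E\<^sub>S) (lam \<mu> * t / real N) ** pulse (b \<mu>)) [1..<2*r+1])) N)
      \<longlonglongrightarrow> evolution (target_hamiltonian \<beta> E\<^sub>T) t" for t
  proof -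
    define K where "K \<mu> = (- \<i> * of_real t) *\<^sub>C (lam \<mu> *\<^sub>R H \<mu>)" for \<mu>
    have "adj (pulse (b \<mu>)) ** evolution (system_hamiltonian \<alpha> E\<^sub>S) (lam \<mu> * t / real N) ** pulse (b \<mu>)
        = mexp (K \<mu> /\<^sub>R real N)" for \<mu> N
    proof -
      \<comment> \<open>This holds at \<open>N = 0\<close> as well: division by 0 yields 0, so both
        sides vanish.\<close>
      have "(- \<i> * of_real (lam \<mu> * t / real N)) *\<^sub>C H \<mu> = K \<mu> /\<^sub>R real N"
        by (simp add: K_def cscale_def vec_eq_iff, simp add: scaleR_conv_of_real divide_inverse mult_ac)
      then show ?thesis
        by (simp add: evolution_def adj_pulse cscale_matrix_mult conjugate_system_hamiltonian
            flip: mexp_conjugate H_def)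
    qed
    \<comment> \<open>The half-open list \<open>[1..<2*r+1]\<close> runs through the index set
      \<open>{1..2 * r}\<close> of \<open>sumH\<close>.\<close>
    moreover have "sum_list (map K [1..<2*r+1]) = (- \<i> * of_real t) *\<^sub>C target_hamiltonian \<beta> E\<^sub>T"
      unfolding sumH[symmetric] cscale_sum K_def
      by (simp add: interv_sum_list_conv_sum_set_nat atLeastLessThanSuc_atLeastAtMost del: upt_Suc)
    ultimately show ?thesis
      using matrix_trotter_product[of "map K [1..<2*r+1]"]
      by (simp add: evolution_def o_def del: upt_Suc)
  qed
  then show ?thesis using lam(1) by blast
qed

end
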